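(* Let $(a,u,v):\mathbb{R}^2\to su(2)^3$ be a solution of the $-1$ flow equation associated to $SU(2)$, i.e. $a_\eta=0$, $u_\eta=[a,v]$, $v_\xi=-[u,v]$, let $E(\xi,\eta,\lambda)$ be the trivialization of its Lax pair, and let $s=E(\cdot,\cdot,-1)E(\cdot,\cdot,1)^{-1}$ be the corresponding wave map into $SU(2)$. If $a$ and $v$ take values in $\mathcal{P}$ and $u$ takes values in $\mathcal{K}$, then $s$ is a wave map into $S^2$.
   Context: Coordinates on $\mathbb{R}^{1,1}$: $\xi=\frac{x+t}{2}$, $\eta=\frac{x-t}{2}$. A wave map $s:\mathbb{R}^{1,1}\to SU(2)$ is a smooth map with $(s^{-1}s_t)_t=(s^{-1}s_x)_x$. The trivialization $E(\xi,\eta,\lambda)$, $\lambda\in\mathbb{C}\setminus\{0\}$, of the Lax pair $\theta_\lambda=(a\lambda+u)d\xi+\lambda^{-1}v\,d\eta$ is the solution of $E_\xi=E(a\lambda+u)$, $E_\eta=\lambda^{-1}Ev$, $E(0,0,\lambda)=\mathrm{I}$. The subspaces $\mathcal{K}=so(2)$ and $\mathcal{P}=\{y\in su(2): y^t=y\}$ are the $+1$ and $-1$ eigenspaces of $\sigma_*(y)=-y^t$ on $su(2)$. $S^2$ is identified with the totally geodesic $2$-sphere $\{y\in SU(2): y^t=y\}$ of $SU(2)=S^3$; a wave map into $SU(2)$ with image in this sphere is a wave map into $S^2$. *)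

theory Defs
  imports "HOL-Analysis.Analysis"
begin

type_synonym mat2 = "complex^2^2"

subsection \<open>Smooth maps on the plane\<close>

text \<open>Iterated Frechet differentiability in all directions; on a finite-dimensional domain this is
  the usual notion of a map of class \<open>C\<^sup>k\<close>.\<close>

primrec class_C :: "nat \<Rightarrow> ('a::real_normed_vector \<Rightarrow> 'b::real_normed_vector) \<Rightarrow> bool" where
  "class_C 0 f \<longleftrightarrow> continuous_on UNIV f"
| "class_C (Suc k) f \<longleftrightarrow>
     (\<forall>x. f differentiable (at x)) \<and> (\<forall>h. class_C k (\<lambda>x. frechet_derivative f (at x) h))"

definition smooth_map :: "('a::euclidean_space \<Rightarrow> 'b::real_normed_vector) \<Rightarrow> bool" where
  "smooth_map f \<longleftrightarrow> (\<forall>k. class_C k f)"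

definition partial1 :: "(real \<times> real \<Rightarrow> 'b::real_normed_vector) \<Rightarrow> real \<times> real \<Rightarrow> 'b" where
  "partial1 f p = vector_derivative (\<lambda>r. f (r, snd p)) (at (fst p))"

definition partial2 :: "(real \<times> real \<Rightarrow> 'b::real_normed_vector) \<Rightarrow> real \<times> real \<Rightarrow> 'b" where
  "partial2 f p = vector_derivative (\<lambda>r. f (fst p, r)) (at (snd p))"

subsection \<open>The group, its Lie algebra and the Cartan decomposition\<close>

definition adjoint_mat :: "mat2 \<Rightarrow> mat2" where
  "adjoint_mat A = (\<chi> i j. cnj (A $ j $ i))"

definition cscale :: "complex \<Rightarrow> mat2 \<Rightarrow> mat2" where
  "cscale c A = (\<chi> i j. c * A $ i $ j)"

definition bracket :: "mat2 \<Rightarrow> mat2 \<Rightarrow> mat2" where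
  "bracket A B = A ** B - B ** A"

definition SU2 :: "mat2 set" where
  "SU2 = {A. adjoint_mat A ** A = mat 1 \<and> det A = 1}"

definition su2 :: "mat2 set" where
  "su2 = {A. adjoint_mat A = - A \<and> trace A = 0}"

definition sigma_star :: "mat2 \<Rightarrow> mat2" where
  "sigma_star y = - transpose y"

text \<open>\<open>so(2)\<close>: the real skew-symmetric matrices, viewed inside the complex ones.\<close>

definition K_space :: "mat2 set" where
  "K_space = {y. (\<forall>i j. y $ i $ j \<in> \<real>) \<and> transpose y = - y}"

definition P_space :: "mat2 set" where
  "P_space = {y \<in> su2. transpose y = y}"

lemma K_space_eigenspace: "K_space = {y \<in> su2. sigma_star y = y}"
proof -
  have "(\<forall>i j. y $ i $ j \<in> \<real>) \<longleftrightarrow> adjoint_mat y = - y \<and> trace y = 0"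
    if t: "transpose y = - y" for y :: mat2
  proof -
    have e: "y $ j $ i = - (y $ i $ j)" for i j
      using arg_cong[OF t, of "\<lambda>z. z $ i $ j"] by (simp add: transpose_def)
    have d: "y $ i $ i = 0" for i
      using e[of i i] by simp
    have "adjoint_mat y = - y \<longleftrightarrow> (\<forall>i j. cnj (y $ i $ j) = y $ i $ j)"
      unfolding adjoint_mat_def vec_eq_iff by (simp, metis e complex_cnj_minus neg_equal_iff_equal)
    then show ?thesis
      by (simp add: trace_def d Reals_cnj_iff)
  qed
  moreover have "sigma_star y = y \<longleftrightarrow> transpose y = - y" for y
    unfolding sigma_star_def by (metis minus_minus)
  ultimately show ?thesis
    unfolding K_space_def su2_def by blast
qed

lemma P_space_eigenspace: "P_space = {y \<in> su2. sigma_star y = - y}"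
  by (auto simp: P_space_def sigma_star_def)

subsection \<open>The \<open>-1\<close> flow and its trivialization\<close>

text \<open>The plane carries the light-cone coordinates: \<open>partial1\<close> is the derivative in \<open>\<xi>\<close>,
  \<open>partial2\<close> the one in \<open>\<eta>\<close>.\<close>

definition minus_one_flow ::
  "(real \<times> real \<Rightarrow> mat2) \<Rightarrow> (real \<times> real \<Rightarrow> mat2) \<Rightarrow> (real \<times> real \<Rightarrow> mat2) \<Rightarrow> bool" where
  "minus_one_flow a u v \<longleftrightarrow>
     smooth_map a \<and> smooth_map u \<and> smooth_map v \<and>
     range a \<subseteq> su2 \<and> range u \<subseteq> su2 \<and> range v \<subseteq> su2 \<and>
     (\<forall>p. partial2 a p = 0) \<and>
     (\<forall>p. partial2 u p = bracket (a p) (v p)) \<and>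
     (\<forall>p. partial1 v p = - bracket (u p) (v p))"

text \<open>The equations determine \<open>E\<close> uniquely, and joint smoothness in \<open>(\<xi>, \<eta>)\<close> is a consequence
  of them when \<open>a\<close>, \<open>u\<close>, \<open>v\<close> are smooth; hence only the partial derivatives are required to exist.\<close>

definition trivialization ::
  "(real \<times> real \<Rightarrow> mat2) \<Rightarrow> (real \<times> real \<Rightarrow> mat2) \<Rightarrow> (real \<times> real \<Rightarrow> mat2) \<Rightarrow>
   (real \<times> real \<Rightarrow> complex \<Rightarrow> mat2) \<Rightarrow> bool" where
  "trivialization a u v E \<longleftrightarrow>
     (\<forall>\<mu>. \<mu> \<noteq> 0 \<longrightarrow>
        E (0, 0) \<mu> = mat 1 \<and>
        (\<forall>\<xi> \<eta>. ((\<lambda>r. E (r, \<eta>) \<mu>) has_vector_derivative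
                  E (\<xi>, \<eta>) \<mu> ** (cscale \<mu> (a (\<xi>, \<eta>)) + u (\<xi>, \<eta>))) (at \<xi>)) \<and>
        (\<forall>\<xi> \<eta>. ((\<lambda>r. E (\<xi>, r) \<mu>) has_vector_derivative
                  cscale (inverse \<mu>) (E (\<xi>, \<eta>) \<mu> ** v (\<xi>, \<eta>))) (at \<eta>)))"

subsection \<open>Wave maps\<close>

text \<open>Here the plane carries the coordinates \<open>(x, t)\<close>: \<open>partial1\<close> is the derivative in \<open>x\<close>,
  \<open>partial2\<close> the one in \<open>t\<close>.\<close>

definition wave_map_SU2 :: "(real \<times> real \<Rightarrow> mat2) \<Rightarrow> bool" where
  "wave_map_SU2 s \<longleftrightarrow>
     smooth_map s \<and> range s \<subseteq> SU2 \<and>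
     (\<forall>p. partial2 (\<lambda>q. matrix_inv (s q) ** partial2 s q) p =
          partial1 (\<lambda>q. matrix_inv (s q) ** partial1 s q) p)"

text \<open>The totally geodesic \<open>2\<close>-sphere in \<open>SU(2) = S\<^sup>3\<close>.\<close>

definition S2_sphere :: "mat2 set" where
  "S2_sphere = {y \<in> SU2. transpose y = y}"

definition wave_map_S2 :: "(real \<times> real \<Rightarrow> mat2) \<Rightarrow> bool" where
  "wave_map_S2 s \<longleftrightarrow> wave_map_SU2 s \<and> range s \<subseteq> S2_sphere"

text \<open>A map given in light-cone coordinates \<open>(\<xi>, \<eta>)\<close>, rewritten in the coordinates \<open>(x, t)\<close>.\<close>

definition in_xt :: "(real \<times> real \<Rightarrow> 'b) \<Rightarrow> real \<times> real \<Rightarrow> 'b" where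
  "in_xt f = (\<lambda>(x, t). f ((x + t) / 2, (x - t) / 2))"

end

theory Submission
  imports Defs
begin

text \<open>Transposing the Lax pair shows that \<open>E(-\<lambda>)\<close> and \<open>E(\<lambda>)\<^sup>t\<close> are inverse to each other, because
  \<open>(a \<lambda> + u)\<^sup>t = - (- a \<lambda> + u)\<close> for \<open>a\<close> symmetric and \<open>u\<close> skew-symmetric. Hence \<open>s = F F\<^sup>t\<close> with
  \<open>F = E(-1)\<close>, which is symmetric. With \<open>G = E(1)\<close> one gets \<open>s\<^sup>-\<^sup>1 s\<^sub>\<xi> = -2 G a G\<^sup>-\<^sup>1\<close> and
  \<open>s\<^sup>-\<^sup>1 s\<^sub>\<eta> = -2 G v G\<^sup>-\<^sup>1\<close>, and the wave equation becomes
  \<open>(G v G\<^sup>-\<^sup>1)\<^sub>\<xi> + (G a G\<^sup>-\<^sup>1)\<^sub>\<eta> = G ([a, v] + [v, a]) G\<^sup>-\<^sup>1 = 0\<close>.\<close>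

section \<open>Calculus of smooth maps\<close>

lemma class_C_Suc_imp: "class_C (Suc k) f \<Longrightarrow> class_C k f"
proof (induction k arbitrary: f)
  case 0
  then show ?case
    by (auto simp: continuous_on_eq_continuous_at intro: differentiable_imp_continuous_within)
next
  case (Suc k)
  have "\<forall>x. f differentiable (at x)" and "\<forall>h. class_C (Suc k) (\<lambda>x. frechet_derivative f (at x) h)"
    using Suc.prems class_C.simps(2) by blast+
  then show ?case
    using Suc.IH by simp
qed

text \<open>Uniqueness of the Frechet derivative lets any explicit formula \<open>f'\<close> replace
  \<open>frechet_derivative\<close>, so the inductions below can work with product and chain rule
  expressions.\<close>

lemma class_C_SucI:
  assumes "\<And>x. (f has_derivative f' x) (at x)" and "\<And>h. class_C k (\<lambda>x. f' x h)"
  shows "class_C (Suc k) f"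
proof -
  have "frechet_derivative f (at x) = f' x" for x
    using frechet_derivative_at[OF assms(1)] by simp
  then show ?thesis
    using assms by (auto simp: differentiable_def)
qed

lemma class_C_SucD:
  assumes "class_C (Suc k) f"
  shows "(f has_derivative frechet_derivative f (at x)) (at x)"
    and "class_C k (\<lambda>x. frechet_derivative f (at x) h)"
  using assms frechet_derivative_works by auto

lemma class_C_add: "class_C k f \<Longrightarrow> class_C k g \<Longrightarrow> class_C k (\<lambda>x. f x + g x)"
proof (induction k arbitrary: f g)
  case 0
  then show ?case by (simp add: continuous_on_add)
next
  case (Suc k)
  show ?case
    by (rule class_C_SucI[OF has_derivative_add[OF class_C_SucD(1)[OF Suc.prems(1)]
            class_C_SucD(1)[OF Suc.prems(2)]]])
      (intro Suc.IH class_C_SucD(2) Suc.prems)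
qed

lemma (in bounded_linear) class_C: "class_C k g \<Longrightarrow> class_C k (\<lambda>x. f (g x))"
proof (induction k arbitrary: g)
  case 0
  then show ?case by (simp add: continuous_on)
next
  case (Suc k)
  show ?case
    by (rule class_C_SucI[OF has_derivative[OF class_C_SucD(1)[OF Suc.prems]]])
      (intro Suc.IH class_C_SucD(2) Suc.prems)
qed

text \<open>The product rule gives a sum of products of the same bilinear kind. In each summand one
  factor stays undifferentiated, and \<open>class_C_Suc_imp\<close> lowers it to the order of the
  induction hypothesis.\<close>

lemma (in bounded_bilinear) class_C:
  "class_C k f \<Longrightarrow> class_C k g \<Longrightarrow> class_C k (\<lambda>x. prod (f x) (g x))"
proof (induction k arbitrary: f g)
  case 0
  then show ?case by (simp add: continuous_on)
next
  case (Suc k)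
  show ?case
    by (rule class_C_SucI[OF FDERIV[OF class_C_SucD(1)[OF Suc.prems(1)]
            class_C_SucD(1)[OF Suc.prems(2)]]])
      (intro class_C_add Suc.IH class_C_SucD(2) Suc.prems class_C_Suc_imp[OF Suc.prems(1)]
        class_C_Suc_imp[OF Suc.prems(2)])
qed

text \<open>For a linear inner map the chain rule produces the derivative of \<open>g\<close> at
  \<open>f x\<close> in the direction \<open>f h\<close>, which does not depend on \<open>x\<close>.
  It is again a map composed with \<open>f\<close>, so the induction closes.\<close>

lemma (in bounded_linear) class_C_compose: "class_C k g \<Longrightarrow> class_C k (\<lambda>x. g (f x))"
proof (induction k arbitrary: g)
  case 0
  then show ?case
    using continuous_on_compose2[of UNIV g UNIV f] by (simp add: linear_continuous_on bounded_linear)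
next
  case (Suc k)
  have "((\<lambda>x. g (f x)) has_derivative (\<lambda>h. frechet_derivative g (at (f x)) (f h))) (at x)" for x
    by (rule has_derivative_compose[OF bounded_linear_imp_has_derivative[OF bounded_linear]
          class_C_SucD(1)[OF Suc.prems]])
  then show ?case
    by (rule class_C_SucI) (intro Suc.IH class_C_SucD(2) Suc.prems)
qed

lemma smooth_map_differentiable: "smooth_map f \<Longrightarrow> f differentiable (at x)"
  unfolding smooth_map_def by (metis class_C.simps(2))

lemma smooth_map_continuous: "smooth_map f \<Longrightarrow> continuous_on UNIV f"
  unfolding smooth_map_def by (metis class_C.simps(1))

section \<open>Partial derivatives on the plane\<close>

lemma has_derivative_imp_partials:
  fixes f :: "real \<times> real \<Rightarrow> 'b::real_normed_vector"
  assumes "(f has_derivative f') (at (x, y))"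
  shows "((\<lambda>r. f (r, y)) has_vector_derivative f' (1, 0)) (at x)"
    and "((\<lambda>r. f (x, r)) has_vector_derivative f' (0, 1)) (at y)"
proof -
  interpret bounded_linear f'
    using assms by (rule has_derivative_bounded_linear)
  have "((\<lambda>r. (r, y)) has_derivative (\<lambda>h. (h, 0))) (at x)"
    "((\<lambda>r. (x, r)) has_derivative (\<lambda>h. (0, h))) (at y)"
    by (auto intro!: derivative_eq_intros)
  from this[THEN has_derivative_compose, OF assms]
  have "((\<lambda>r. f (r, y)) has_derivative (\<lambda>h. f' (h, 0))) (at x)"
    "((\<lambda>r. f (x, r)) has_derivative (\<lambda>h. f' (0, h))) (at y)"
    by simp_all
  moreover have "(\<lambda>h. f' (h, 0)) = (\<lambda>h. h *\<^sub>R f' (1, 0))"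
    "(\<lambda>h. f' (0, h)) = (\<lambda>h. h *\<^sub>R f' (0, 1))"
    by (simp_all add: fun_eq_iff flip: scaleR)
  ultimately show "((\<lambda>r. f (r, y)) has_vector_derivative f' (1, 0)) (at x)"
    and "((\<lambda>r. f (x, r)) has_vector_derivative f' (0, 1)) (at y)"
    by (simp_all add: has_vector_derivative_def)
qed

lemma differentiable_imp_has_vector_derivative_partials:
  fixes f :: "real \<times> real \<Rightarrow> 'b::real_normed_vector"
  assumes "f differentiable (at (x, y))"
  shows "((\<lambda>r. f (r, y)) has_vector_derivative partial1 f (x, y)) (at x)"
    and "((\<lambda>r. f (x, r)) has_vector_derivative partial2 f (x, y)) (at y)"
  using assms has_derivative_imp_partials[of f _ x y] differentiableI_vector
  unfolding differentiable_def[of f] partial1_def partial2_def fst_conv snd_conv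
    vector_derivative_works[symmetric] by blast+

text \<open>Differentiability is given, so the derivative is linear and is determined by its values
  on the basis \<open>(1, 0)\<close>, \<open>(0, 1)\<close>, which are the partial
  derivatives.\<close>

lemma has_derivative_from_partials:
  fixes f :: "real \<times> real \<Rightarrow> 'b::real_normed_vector"
  assumes "f differentiable (at (x, y))"
    and "((\<lambda>r. f (r, y)) has_vector_derivative D1) (at x)"
    and "((\<lambda>r. f (x, r)) has_vector_derivative D2) (at y)"
  shows "(f has_derivative (\<lambda>h. fst h *\<^sub>R D1 + snd h *\<^sub>R D2)) (at (x, y))"
proof -
  obtain f' where f': "(f has_derivative f') (at (x, y))"
    using assms(1) by (auto simp: differentiable_def)
  interpret bounded_linear f'
    using f' by (rule has_derivative_bounded_linear)
  have "f' (1, 0) = D1" "f' (0, 1) = D2"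
    using vector_derivative_unique_at has_derivative_imp_partials[OF f'] assms(2,3) by blast+
  moreover have "f' h = f' (fst h *\<^sub>R (1, 0) + snd h *\<^sub>R (0, 1))" for h
    by simp
  ultimately have "f' h = fst h *\<^sub>R D1 + snd h *\<^sub>R D2" for h
    by (simp only: add scaleR)
  then have "f' = (\<lambda>h. fst h *\<^sub>R D1 + snd h *\<^sub>R D2)"
    by auto
  then show ?thesis
    using f' by simp
qed

section \<open>From light-cone coordinates to (x, t)\<close>

lemma in_xt_apply: "in_xt f (x, t) = f ((x + t) / 2, (x - t) / 2)"
  by (simp add: in_xt_def)

lemma partials_in_xt:
  assumes "(f has_derivative (\<lambda>h. fst h *\<^sub>R D1 + snd h *\<^sub>R D2)) (at ((x + t) / 2, (x - t) / 2))"
  shows "partial1 (in_xt f) (x, t) = (1/2) *\<^sub>R (D1 + D2)"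
    and "partial2 (in_xt f) (x, t) = (1/2) *\<^sub>R (D1 - D2)"
proof -
  have "((\<lambda>r. ((r + t) / 2, (r - t) / 2)) has_derivative (\<lambda>h. (h / 2, h / 2))) (at x)"
    "((\<lambda>r. ((x + r) / 2, (x - r) / 2)) has_derivative (\<lambda>h. (h / 2, - h / 2))) (at t)"
    by (auto intro!: derivative_eq_intros)
  from this[THEN has_derivative_compose, OF assms]
  have "((\<lambda>r. in_xt f (r, t)) has_vector_derivative (1/2) *\<^sub>R (D1 + D2)) (at x)"
    "((\<lambda>r. in_xt f (x, r)) has_vector_derivative (1/2) *\<^sub>R (D1 - D2)) (at t)"
    by (simp_all add: has_vector_derivative_def in_xt_def algebra_simps)
  then show "partial1 (in_xt f) (x, t) = (1/2) *\<^sub>R (D1 + D2)"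
    and "partial2 (in_xt f) (x, t) = (1/2) *\<^sub>R (D1 - D2)"
    by (simp_all add: partial1_def partial2_def vector_derivative_at)
qed

lemma class_C_in_xt: "class_C k f \<Longrightarrow> class_C k (in_xt f)"
proof -
  have "bounded_linear (\<lambda>p::real \<times> real. ((fst p + snd p) / 2, (fst p - snd p) / 2))"
    by (intro bounded_linear_Pair bounded_linear_divide bounded_linear_compose[OF bounded_linear_divide]
        bounded_linear_add bounded_linear_sub bounded_linear_fst bounded_linear_snd)
  moreover have "in_xt f = (\<lambda>p. f ((fst p + snd p) / 2, (fst p - snd p) / 2))"
    by (auto simp: in_xt_def)
  ultimately show "class_C k f \<Longrightarrow> class_C k (in_xt f)"
    using bounded_linear.class_C_compose by fastforce
qed

section \<open>Constancy, continuity and differentiability from partial derivatives\<close>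

lemma partials_zero_imp_constant:
  fixes f :: "real \<times> real \<Rightarrow> 'b::real_normed_vector"
  assumes "\<And>x y. ((\<lambda>r. f (r, y)) has_vector_derivative 0) (at x)"
    and "\<And>x y. ((\<lambda>r. f (x, r)) has_vector_derivative 0) (at y)"
  shows "f p = f q"
proof -
  have c: "g a = g b" if "\<And>x. (g has_vector_derivative 0) (at x)" for g :: "real \<Rightarrow> 'b" and a b
    using has_vector_derivative_zero_constant[of UNIV g] that by (metis UNIV_I convex_UNIV)
  have "f (fst p, snd p) = f (fst q, snd p)"
    using assms(1) by (rule c)
  also have "\<dots> = f (fst q, snd q)"
    using assms(2) by (rule c)
  finally show ?thesis
    by simp
qed

text \<open>A locally bounded first partial derivative makes \<open>f\<close> Lipschitz in the first
  variable, with a constant uniform in the second. Together with continuity along vertical lines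
  this gives joint continuity.\<close>

lemma continuous_on_bounded_partial:
  fixes f :: "real \<times> real \<Rightarrow> 'b::real_normed_vector"
  assumes d1: "\<And>x y. ((\<lambda>r. f (r, y)) has_vector_derivative D (x, y)) (at x)"
    and d2: "\<And>x. continuous_on UNIV (\<lambda>y. f (x, y))"
    and bdd: "\<And>S. bounded S \<Longrightarrow> bounded (D ` S)"
  shows "continuous_on UNIV f"
proof -
  have "isCont f (a, b)" for a b
  proof -
    define S where "S = {a - 1..a + 1} \<times> {b - 1..b + 1}"
    have "bounded (D ` S)"
      unfolding S_def by (intro bdd bounded_Times) auto
    then obtain M where M: "\<And>p. p \<in> S \<Longrightarrow> norm (D p) \<le> M"
      by (auto simp: bounded_iff)
    have lip: "norm (f (x, y) - f (a, y)) \<le> M * norm (x - a)" if "(x, y) \<in> S" for x y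
    proof (rule differentiable_bound[where S = "{a - 1..a + 1}"])
      show "((\<lambda>r. f (r, y)) has_derivative (\<lambda>h. h *\<^sub>R D (z, y))) (at z within {a - 1..a + 1})" for z
        using d1[where x = z and y = y]
        by (auto simp: has_vector_derivative_def intro: has_derivative_at_withinI)
      show "onorm (\<lambda>h. h *\<^sub>R D (z, y)) \<le> M" if "z \<in> {a - 1..a + 1}" for z
        using M[of "(z, y)"] that \<open>(x, y) \<in> S\<close>
        by (intro onorm_le) (simp add: S_def mult.commute[of M] mult_left_mono)
    qed (use that in \<open>auto simp: S_def\<close>)
    have "((\<lambda>p. f (a, snd p)) \<longlongrightarrow> f (a, b)) (at (a, b))"
    proof -
      have "isCont (\<lambda>y. f (a, y)) (snd (a, b))"
        using d2 by (simp add: continuous_on_eq_continuous_at)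
      from isCont_o2[OF isCont_snd[OF continuous_ident] this] show ?thesis
        by (simp add: isCont_def)
    qed
    \<comment> \<open>Squeeze: by \<open>lip\<close> the horizontal increment is at most
      \<open>M\<close> times the distance to the line through \<open>a\<close>.\<close>
    moreover have "((\<lambda>p. f p - f (a, snd p)) \<longlongrightarrow> 0) (at (a, b))"
    proof (rule Lim_null_comparison)
      have "open ({a - 1<..<a + 1} \<times> {b - 1<..<b + 1})"
        by (intro open_Times) auto
      then have "\<forall>\<^sub>F p in at (a, b). p \<in> {a - 1<..<a + 1} \<times> {b - 1<..<b + 1}"
        by (rule eventually_at_in_open') auto
      then show "\<forall>\<^sub>F p in at (a, b). norm (f p - f (a, snd p)) \<le> M * norm (fst p - a)"
        by eventually_elim (use lip in \<open>auto simp: S_def\<close>)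
      have "isCont (\<lambda>p::real \<times> real. M * norm (fst p - a)) (a, b)"
        by (intro continuous_intros)
      then show "((\<lambda>p. M * norm (fst p - a)) \<longlongrightarrow> 0) (at (a, b))"
        by (simp add: isCont_def)
    qed
    ultimately have "((\<lambda>p. f p - f (a, snd p) + f (a, snd p)) \<longlongrightarrow> 0 + f (a, b)) (at (a, b))"
      by (intro tendsto_add)
    then show ?thesis
      by (simp add: isCont_def)
  qed
  then show ?thesis
    by (auto simp: continuous_on_eq_continuous_at)
qed

text \<open>Split the increment at a corner: the vertical piece is controlled uniformly by
  continuity of \<open>D2\<close>, the horizontal one by differentiability along a single
  line.\<close>

lemma has_derivative_continuous_partials:
  fixes f :: "real \<times> real \<Rightarrow> 'b::real_normed_vector"
  assumes d1: "\<And>x y. ((\<lambda>r. f (r, y)) has_vector_derivative D1 (x, y)) (at x)"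
    and d2: "\<And>x y. ((\<lambda>r. f (x, r)) has_vector_derivative D2 (x, y)) (at y)"
    and cont: "continuous_on UNIV D2"
  shows "(f has_derivative (\<lambda>h. fst h *\<^sub>R D1 p + snd h *\<^sub>R D2 p)) (at p)"
proof -
  obtain x y where p: "p = (x, y)"
    by fastforce
  \<comment> \<open>\<open>blinfun_scaleR_left\<close> turns the vector \<open>D2\<close> into the
    linear map it represents, since the criterion asks for continuity in operator norm.\<close>
  have "((\<lambda>(x, y). f (x, y)) has_derivative
      (\<lambda>(tx, ty). tx *\<^sub>R D1 (x, y) + blinfun_scaleR_left (D2 (x, y)) ty)) (at (x, y) within UNIV \<times> UNIV)"
  proof (rule has_derivative_partialsI)
    show "((\<lambda>x. f (x, y)) has_derivative (\<lambda>tx. tx *\<^sub>R D1 (x, y))) (at x)"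
      using d1 by (simp add: has_vector_derivative_def)
    show "((\<lambda>y. f (x, y)) has_derivative blinfun_apply (blinfun_scaleR_left (D2 (x, y)))) (at y)"
      for x y
      using d2 by (simp add: has_vector_derivative_def)
    have "isCont D2 (x, y)"
      using cont by (simp add: continuous_on_eq_continuous_at)
    then have "isCont (\<lambda>p. blinfun_scaleR_left (D2 p)) (x, y)"
      by (rule bounded_linear.isCont[OF bounded_linear_blinfun_scaleR_left])
    then show "continuous (at (x, y) within UNIV \<times> UNIV) (\<lambda>(x, y). blinfun_scaleR_left (D2 (x, y)))"
      by (simp add: case_prod_unfold)
  qed auto
  then show ?thesis
    by (simp add: p case_prod_unfold)
qed

section \<open>Matrices\<close>

lemma bounded_bilinear_mat2: "bounded_bilinear ((**) :: mat2 \<Rightarrow> mat2 \<Rightarrow> mat2)"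
  unfolding bilinear_conv_bounded_bilinear[symmetric] bilinear_def
  by (auto intro!: linearI simp: matrix_matrix_mult_def vec_eq_iff sum.distrib algebra_simps scaleR_sum_right)

interpretation mm: bounded_bilinear "(**) :: mat2 \<Rightarrow> mat2 \<Rightarrow> mat2"
  by (rule bounded_bilinear_mat2)

lemma bounded_linear_transpose_mat2: "bounded_linear (transpose :: mat2 \<Rightarrow> mat2)"
  unfolding linear_conv_bounded_linear[symmetric]
  by (auto intro!: linearI simp: transpose_def vec_eq_iff)

lemma bounded_linear_adjoint_mat: "bounded_linear adjoint_mat"
  unfolding linear_conv_bounded_linear[symmetric]
  by (auto intro!: linearI simp: adjoint_mat_def vec_eq_iff)

lemma adjoint_mat_mult: "adjoint_mat (A ** B) = adjoint_mat B ** adjoint_mat A"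
  by (simp add: adjoint_mat_def matrix_matrix_mult_def vec_eq_iff mult.commute)

lemma adjoint_mat_one: "adjoint_mat (mat 1) = mat 1"
  by (auto simp: adjoint_mat_def mat_def vec_eq_iff)

lemma adjoint_mat_transpose: "adjoint_mat (transpose A) = transpose (adjoint_mat A)"
  by (auto simp: adjoint_mat_def transpose_def vec_eq_iff)

lemma matrix_inv_eqI:
  fixes A B :: "'a::field^'n^'n"
  assumes "A ** B = mat 1"
  shows "matrix_inv A = B"
proof -
  have "A ** matrix_inv A = mat 1 \<and> matrix_inv A ** A = mat 1"
    unfolding matrix_inv_def
    by (rule someI_ex) (use assms matrix_left_right_inverse in blast)
  then show ?thesis
    by (metis assms matrix_mul_assoc matrix_mul_lid matrix_mul_rid)
qed

lemma SU2_mult: "A \<in> SU2 \<Longrightarrow> B \<in> SU2 \<Longrightarrow> A ** B \<in> SU2"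
  unfolding SU2_def
  by (simp add: adjoint_mat_mult det_mul) (metis matrix_mul_assoc matrix_mul_lid)

text \<open>The unitarity condition for the transpose is the transpose of
  \<open>A ** adjoint_mat A = mat 1\<close>, the other one-sided form of unitarity for
  \<open>A\<close>.\<close>

lemma SU2_transpose: "A \<in> SU2 \<Longrightarrow> transpose A \<in> SU2"
  unfolding SU2_def
  by (simp add: adjoint_mat_transpose det_transpose flip: matrix_transpose_mul)
    (metis matrix_left_right_inverse transpose_mat)

lemma su2_diff: "A \<in> su2 \<Longrightarrow> B \<in> su2 \<Longrightarrow> A - B \<in> su2"
  and su2_add: "A \<in> su2 \<Longrightarrow> B \<in> su2 \<Longrightarrow> A + B \<in> su2"
  and su2_minus: "A \<in> su2 \<Longrightarrow> - A \<in> su2"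
  by (auto simp: su2_def trace_def sum.distrib sum_subtractf sum_negf linear_simps[OF bounded_linear_adjoint_mat])

text \<open>The squared norm is the trace of \<open>adjoint_mat A ** A\<close>, hence 2 on the whole
  group.\<close>

lemma bounded_SU2: "bounded SU2"
proof -
  have "norm A = sqrt 2" if "A \<in> SU2" for A
  proof -
    have "adjoint_mat A ** A = mat 1"
      using that by (simp add: SU2_def)
    then have diag: "Re ((adjoint_mat A ** A) $ i $ i) = 1" for i
      by (simp add: mat_def)
    have "A \<bullet> A = Re ((adjoint_mat A ** A) $ 1 $ 1) + Re ((adjoint_mat A ** A) $ 2 $ 2)"
      by (simp add: inner_vec_def UNIV_2 adjoint_mat_def matrix_matrix_mult_def inner_complex_def)
    then have "A \<bullet> A = 2"
      unfolding diag by simp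
    then show ?thesis
      by (simp add: norm_eq_sqrt_inner)
  qed
  then show ?thesis
    by (auto simp: bounded_iff)
qed

section \<open>Frames of a flat connection\<close>

text \<open>The Lax pair at one fixed spectral parameter: a parallel frame of the connection A
  d\<xi> + B d\<eta>, normalized at the origin. The values 1 and -1 of the parameter become two
  instances.\<close>

definition frame ::
  "(real \<times> real \<Rightarrow> mat2) \<Rightarrow> (real \<times> real \<Rightarrow> mat2) \<Rightarrow> (real \<times> real \<Rightarrow> mat2) \<Rightarrow> bool" where
  "frame A B f \<longleftrightarrow> f (0, 0) = mat 1 \<and>
     (\<forall>x y. ((\<lambda>r. f (r, y)) has_vector_derivative f (x, y) ** A (x, y)) (at x)) \<and>
     (\<forall>x y. ((\<lambda>r. f (x, r)) has_vector_derivative f (x, y) ** B (x, y)) (at y))"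

text \<open>In either variable the derivative of \<open>f p ** T (g p)\<close> is f (A + T A') T(g),
  or its analogue with B, and so vanishes. Taking the adjoint for \<open>T\<close> yields unitarity;
  taking the transpose yields the symmetry that relates the two frames.\<close>

lemma frame_duality:
  assumes f: "frame A B f" and g: "frame A' B' g" and T: "bounded_linear T"
    and anti: "\<And>X Y. T (X ** Y) = T Y ** T X" and one: "T (mat 1) = mat 1"
    and A: "\<And>p. T (A' p) = - A p" and B: "\<And>p. T (B' p) = - B p"
  shows "f p ** T (g p) = mat 1"
proof -
  have "f p ** T (g p) = f (0, 0) ** T (g (0, 0))"
  proof (rule partials_zero_imp_constant)
    fix x y
    have "((\<lambda>r. f (r, y) ** T (g (r, y))) has_vector_derivative
        f (x, y) ** T (g (x, y) ** A' (x, y)) + (f (x, y) ** A (x, y)) ** T (g (x, y))) (at x)"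
      using f g unfolding frame_def
      by (intro mm.has_vector_derivative bounded_linear.has_vector_derivative[OF T]) auto
    then show "((\<lambda>r. f (r, y) ** T (g (r, y))) has_vector_derivative 0) (at x)"
      by (simp add: anti A mm.minus_left mm.minus_right matrix_mul_assoc)
    have "((\<lambda>r. f (x, r) ** T (g (x, r))) has_vector_derivative
        f (x, y) ** T (g (x, y) ** B' (x, y)) + (f (x, y) ** B (x, y)) ** T (g (x, y))) (at y)"
      using f g unfolding frame_def
      by (intro mm.has_vector_derivative bounded_linear.has_vector_derivative[OF T]) auto
    then show "((\<lambda>r. f (x, r) ** T (g (x, r))) has_vector_derivative 0) (at y)"
      by (simp add: anti B mm.minus_left mm.minus_right matrix_mul_assoc)
  qed
  also have "\<dots> = mat 1"
    using f g one by (simp add: frame_def)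
  finally show ?thesis .
qed

text \<open>Jacobi's formula (det X)' = det X * trace A, verified by expanding the 2 by 2
  determinant.\<close>

lemma has_vector_derivative_det_zero:
  fixes X :: "real \<Rightarrow> mat2"
  assumes X: "(X has_vector_derivative X t ** A) (at t)" and tr: "trace A = 0"
  shows "((\<lambda>r. det (X r)) has_vector_derivative 0) (at t)"
proof -
  have e: "((\<lambda>r. X r $ i $ j) has_vector_derivative (X t ** A) $ i $ j) (at t)" for i j
    by (intro bounded_linear.has_vector_derivative[OF bounded_linear_vec_nth] X)
  have "A $ 2 $ 2 = - A $ 1 $ 1"
    using tr by (simp add: trace_def UNIV_2 add_eq_0_iff)
  then show ?thesis
    unfolding det_2
    by (auto intro!: derivative_eq_intros e simp: matrix_matrix_mult_def UNIV_2 algebra_simps)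
qed

text \<open>Duality of \<open>f\<close> with itself under the adjoint uses that the coefficients are
  skew-Hermitian; constancy of the determinant uses that they are traceless.\<close>

lemma frame_SU2:
  assumes f: "frame A B f" and A: "range A \<subseteq> su2" and B: "range B \<subseteq> su2"
  shows "f p \<in> SU2"
proof -
  have "f p ** adjoint_mat (f p) = mat 1"
    by (rule frame_duality[OF f f bounded_linear_adjoint_mat adjoint_mat_mult adjoint_mat_one])
      (use A B in \<open>auto simp: su2_def\<close>)
  moreover have "det (f p) = det (f (0, 0))"
    by (rule partials_zero_imp_constant; rule has_vector_derivative_det_zero)
      (use f A B in \<open>auto simp: frame_def su2_def\<close>)
  ultimately show ?thesis
    using f by (simp add: SU2_def frame_def matrix_left_right_inverse)
qed

text \<open>Continuity of the frame is not part of \<^const>\<open>frame\<close>: it comes from compactness of \<^const>\<open>SU2\<close>, which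
  bounds the partial derivatives locally. Differentiability of each order then bootstraps.\<close>

lemma frame_smooth:
  assumes f: "frame A B f" and A: "range A \<subseteq> su2" and B: "range B \<subseteq> su2"
    and sA: "smooth_map A" and sB: "smooth_map B"
  shows "smooth_map f"
proof -
  have cont: "continuous_on UNIV f"
  proof (rule continuous_on_bounded_partial)
    show "((\<lambda>r. f (r, y)) has_vector_derivative f (x, y) ** A (x, y)) (at x)" for x y
      using f by (simp add: frame_def)
    show "continuous_on UNIV (\<lambda>y. f (x, y))" for x
      using f unfolding frame_def continuous_on_eq_continuous_at[OF open_UNIV]
      by (metis has_vector_derivative_continuous)
    fix S :: "(real \<times> real) set"
    assume "bounded S"
    have "bounded (f ` S)"
      using frame_SU2[OF f A B] by (intro bounded_subset[OF bounded_SU2]) auto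
    moreover have "bounded (A ` S)"
    proof (rule bounded_subset)
      show "bounded (A ` closure S)"
        using \<open>bounded S\<close> smooth_map_continuous[OF sA]
        by (intro compact_imp_bounded compact_continuous_image)
          (auto intro: continuous_on_subset simp: compact_closure)
    qed (use closure_subset in blast)
    ultimately obtain M N where M: "\<And>p. p \<in> S \<Longrightarrow> norm (f p) \<le> M"
      and N: "\<And>p. p \<in> S \<Longrightarrow> norm (A p) \<le> N"
      unfolding bounded_iff by (metis imageI)
    obtain K where "K > 0" and K: "\<And>X Y. norm ((X :: mat2) ** (Y :: mat2)) \<le> norm X * norm Y * K"
      using mm.pos_bounded by blast
    have "norm (f p ** A p) \<le> M * N * K" if "p \<in> S" for p
    proof -
      have "norm (f p) * norm (A p) \<le> M * N"
        using M[OF that] N[OF that] order_trans[OF norm_ge_zero M[OF that]] by (intro mult_mono) auto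
      then show ?thesis
        using K[of "f p" "A p"] mult_right_mono[OF _ less_imp_le[OF \<open>K > 0\<close>]]
        by (metis order_trans)
    qed
    then show "bounded ((\<lambda>p. f p ** A p) ` S)"
      by (intro boundedI) blast
  qed
  have D: "(f has_derivative (\<lambda>h. fst h *\<^sub>R (f p ** A p) + snd h *\<^sub>R (f p ** B p))) (at p)" for p
    by (rule has_derivative_continuous_partials)
      (use f in \<open>auto simp: frame_def intro: mm.continuous_on cont smooth_map_continuous[OF sB]\<close>)
  have "class_C k f" for k
  proof (induction k)
    case 0
    show ?case using cont by simp
  next
    case (Suc k)
    \<comment> \<open>Each directional derivative is a fixed linear combination of
      \<open>f p ** A p\<close> and \<open>f p ** B p\<close>, hence as regular as \<open>f\<close>
      is by the induction hypothesis.\<close>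
    show ?case
      by (rule class_C_SucI[OF D])
        (use Suc sA sB in \<open>auto simp: smooth_map_def
          intro!: class_C_add bounded_linear.class_C[OF bounded_linear_scaleR_right] mm.class_C\<close>)
  qed
  then show ?thesis
    by (simp add: smooth_map_def)
qed

section \<open>The wave equation\<close>

theorem proposition7p2:
  fixes a u v s :: "real \<times> real \<Rightarrow> complex^2^2"
    and E :: "real \<times> real \<Rightarrow> complex \<Rightarrow> complex^2^2"
  assumes flow: "minus_one_flow a u v"
    and triv: "trivialization a u v E"
    and s: "\<And>p. s p = E p (-1) ** matrix_inv (E p 1)"
    and a: "range a \<subseteq> P_space"
    and v: "range v \<subseteq> P_space"
    and u: "range u \<subseteq> K_space"
  shows "wave_map_S2 (in_xt s)"
proof -
  have smooth: "smooth_map a" "smooth_map u" "smooth_map v"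
    and su2: "range a \<subseteq> su2" "range u \<subseteq> su2" "range v \<subseteq> su2"
    and a_eta: "partial2 a p = 0" and v_xi: "partial1 v p = - bracket (u p) (v p)" for p
    using flow unfolding minus_one_flow_def by blast+
  have at: "transpose (a p) = a p" and vt: "transpose (v p) = v p" and ut: "transpose (u p) = - u p" for p
    using a v u unfolding P_space_def K_space_def by blast+
  \<comment> \<open>These rules expand to sums of left-associated products and eliminate the
    transposes of \<open>a\<close>, \<open>u\<close>, \<open>v\<close>, so that the identities below
    become cancellations.\<close>
  note matrix_simps = mm.add_left mm.add_right mm.diff_left mm.diff_right mm.minus_left mm.minus_right
    mm.scaleR_left mm.scaleR_right matrix_mul_assoc matrix_transpose_mul
    linear_simps[OF bounded_linear_transpose_mat2] at vt ut

  \<comment> \<open>The frames at parameters -1 and 1\<close>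
  define F where "F p = E p (-1)" for p
  define G where "G p = E p 1" for p
  have cs: "cscale 1 X = X" "cscale (- 1) X = - X" for X
    by (simp_all add: cscale_def vec_eq_iff)
  \<comment> \<open>The parameter -1 is its own inverse, so both \<open>a\<close> and
    \<open>v\<close> change sign while \<open>u\<close> is kept.\<close>
  have F: "frame (\<lambda>p. u p - a p) (\<lambda>p. - v p) F"
    using triv[unfolded trivialization_def, rule_format, of "-1"]
    by (simp add: frame_def F_def cs mm.minus_right)
  have G: "frame (\<lambda>p. a p + u p) v G"
    using triv[unfolded trivialization_def, rule_format, of 1]
    by (simp add: frame_def G_def cs)
  have su2_F: "range (\<lambda>p. u p - a p) \<subseteq> su2" "range (\<lambda>p. - v p) \<subseteq> su2"
    and su2_G: "range (\<lambda>p. a p + u p) \<subseteq> su2"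
    using su2 by (auto intro!: su2_add su2_diff su2_minus)
  have smooth_F: "smooth_map (\<lambda>p. u p - a p)" "smooth_map (\<lambda>p. - v p)"
    and smooth_G: "smooth_map (\<lambda>p. a p + u p)"
    using smooth class_C_add[OF _ bounded_linear.class_C[OF bounded_linear_minus[OF bounded_linear_ident]]]
      bounded_linear.class_C[OF bounded_linear_minus[OF bounded_linear_ident]] class_C_add
    unfolding smooth_map_def by fastforce+
  have F_SU2: "F p \<in> SU2" for p
    by (rule frame_SU2[OF F su2_F])
  have F_smooth: "smooth_map F" and G_smooth: "smooth_map G"
    using frame_smooth[OF F su2_F smooth_F] frame_smooth[OF G su2_G su2(3) smooth_G smooth(3)] .

  \<comment> \<open>The wave map, its symmetry and its inverse\<close>
  have FG: "F p ** transpose (G p) = mat 1" for p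
    by (rule frame_duality[OF F G bounded_linear_transpose_mat2 matrix_transpose_mul transpose_mat])
      (simp_all add: matrix_simps)
  have GF: "G p ** transpose (F p) = mat 1" for p
    using arg_cong[OF FG, of transpose] by (simp add: matrix_transpose_mul)
  have s_eq: "s p = F p ** transpose (F p)" for p
    using s matrix_inv_eqI[OF GF] by (simp add: F_def G_def)
  have FF: "adjoint_mat (F p) ** F p = mat 1" for p
    using F_SU2 by (simp add: SU2_def)
  \<comment> \<open>The inverse of \<open>F p\<close> is its adjoint, and by \<open>GF\<close> the
    inverse of \<open>transpose (F p)\<close> is \<open>G p\<close>. The product is computed on one
    side and moved to the other for square matrices.\<close>
  have s_inv: "matrix_inv (s p) = G p ** adjoint_mat (F p)" for p
  proof (rule matrix_inv_eqI)
    have "(G p ** adjoint_mat (F p)) ** s p = G p ** (adjoint_mat (F p) ** F p) ** transpose (F p)"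
      by (simp add: s_eq matrix_mul_assoc)
    then show "s p ** (G p ** adjoint_mat (F p)) = mat 1"
      by (simp add: FF GF matrix_left_right_inverse)
  qed
  have s_SU2: "s p \<in> SU2" and s_sym: "transpose (s p) = s p" for p
    using F_SU2 by (simp_all add: s_eq SU2_mult SU2_transpose matrix_transpose_mul)
  have s_smooth: "smooth_map s"
    using F_smooth unfolding smooth_map_def s_eq
    by (intro allI mm.class_C bounded_linear.class_C[OF bounded_linear_transpose_mat2]) auto

  \<comment> \<open>The logarithmic derivatives of the wave map\<close>
  have F1: "((\<lambda>r. F (r, y)) has_vector_derivative F (x, y) ** (u (x, y) - a (x, y))) (at x)"
    and F2: "((\<lambda>r. F (x, r)) has_vector_derivative - (F (x, y) ** v (x, y))) (at y)"
    and G1: "((\<lambda>r. G (r, y)) has_vector_derivative G (x, y) ** (a (x, y) + u (x, y))) (at x)"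
    and G2: "((\<lambda>r. G (x, r)) has_vector_derivative G (x, y) ** v (x, y)) (at y)" for x y
    using F G by (simp_all add: frame_def mm.minus_right)
  note tr_deriv = bounded_linear.has_vector_derivative[OF bounded_linear_transpose_mat2]

  \<comment> \<open>\<open>J\<close> and \<open>L\<close> are the conjugates of \<open>a\<close> and
    \<open>v\<close> by \<open>G\<close>. Writing the inverse of \<open>G p\<close> as
    \<open>transpose (F p)\<close> makes them plain products, so the product rule applies without
    differentiating an inverse.\<close>
  define J where "J p = G p ** a p ** transpose (F p)" for p
  define L where "L p = G p ** v p ** transpose (F p)" for p
  have J_smooth: "smooth_map J" and L_smooth: "smooth_map L"
    using F_smooth G_smooth smooth unfolding smooth_map_def J_def L_def
    by (auto intro!: mm.class_C bounded_linear.class_C[OF bounded_linear_transpose_mat2])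
  \<comment> \<open>The two terms add u - a to its transpose -u - a: the skew part \<open>u\<close>
    cancels and \<open>a\<close> doubles.\<close>
  have "((\<lambda>r. s (r, y)) has_vector_derivative F (x, y) ** transpose (F (x, y) ** (u (x, y) - a (x, y))) +
      (F (x, y) ** (u (x, y) - a (x, y))) ** transpose (F (x, y))) (at x)" for x y
    unfolding s_eq by (intro mm.has_vector_derivative tr_deriv F1)
  then have s1: "((\<lambda>r. s (r, y)) has_vector_derivative
      - 2 *\<^sub>R (F (x, y) ** a (x, y) ** transpose (F (x, y)))) (at x)" for x y
    by (rule has_vector_derivative_eq_rhs) (simp add: matrix_simps scaleR_2)
  have "((\<lambda>r. s (x, r)) has_vector_derivative F (x, y) ** transpose (- (F (x, y) ** v (x, y))) +
      (- (F (x, y) ** v (x, y))) ** transpose (F (x, y))) (at y)" for x y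
    unfolding s_eq by (intro mm.has_vector_derivative tr_deriv F2)
  then have s2: "((\<lambda>r. s (x, r)) has_vector_derivative
      - 2 *\<^sub>R (F (x, y) ** v (x, y) ** transpose (F (x, y)))) (at y)" for x y
    by (rule has_vector_derivative_eq_rhs) (simp add: matrix_simps scaleR_2)
  note s' = partials_in_xt[OF has_derivative_from_partials[OF smooth_map_differentiable[OF s_smooth] s1 s2]]
  have cancel: "matrix_inv (s p) ** (F p ** X ** transpose (F p)) = G p ** X ** transpose (F p)" for p X
  proof -
    have "matrix_inv (s p) ** (F p ** X ** transpose (F p)) =
        G p ** (adjoint_mat (F p) ** F p) ** X ** transpose (F p)"
      by (simp add: s_inv matrix_mul_assoc)
    then show ?thesis
      by (simp add: FF)
  qed
  \<comment> \<open>The light-cone logarithmic derivatives are -2 J and -2 L by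
    \<open>cancel\<close>; the factor 1/2 from the change of coordinates absorbs the 2.\<close>
  have s_x: "(\<lambda>q. matrix_inv (in_xt s q) ** partial1 (in_xt s) q) = in_xt (\<lambda>p. - (J p + L p))"
    by (auto simp: fun_eq_iff s' in_xt_apply mm.scaleR_right mm.add_right mm.minus_right mm.diff_right cancel
        J_def L_def scaleR_add_right scaleR_diff_right)
  have s_t: "(\<lambda>q. matrix_inv (in_xt s q) ** partial2 (in_xt s) q) = in_xt (\<lambda>p. L p - J p)"
    by (auto simp: fun_eq_iff s' in_xt_apply mm.scaleR_right mm.add_right mm.minus_right mm.diff_right cancel
        J_def L_def scaleR_add_right scaleR_diff_right)

  \<comment> \<open>The conservation law and the wave equation\<close>
  have conservation: "partial1 L p + partial2 J p = 0" for p
  proof -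
    obtain x y where p: "p = (x, y)"
      by fastforce
    have "((\<lambda>r. L (r, y)) has_vector_derivative
        (G p ** v p) ** transpose (F p ** (u p - a p)) +
        (G p ** partial1 v p + (G p ** (a p + u p)) ** v p) ** transpose (F p)) (at x)"
      unfolding L_def p
      by (intro mm.has_vector_derivative tr_deriv F1 G1
          differentiable_imp_has_vector_derivative_partials smooth_map_differentiable smooth)
    then have "partial1 L p = (G p ** v p) ** transpose (F p ** (u p - a p)) +
        (G p ** partial1 v p + (G p ** (a p + u p)) ** v p) ** transpose (F p)"
      by (simp add: partial1_def p vector_derivative_at)
    moreover have "((\<lambda>r. J (x, r)) has_vector_derivative
        (G p ** a p) ** transpose (- (F p ** v p)) +
        (G p ** partial2 a p + (G p ** v p) ** a p) ** transpose (F p)) (at y)"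
      unfolding J_def p
      by (intro mm.has_vector_derivative tr_deriv F2 G2
          differentiable_imp_has_vector_derivative_partials smooth_map_differentiable smooth)
    then have "partial2 J p = (G p ** a p) ** transpose (- (F p ** v p)) +
        (G p ** partial2 a p + (G p ** v p) ** a p) ** transpose (F p)"
      by (simp add: partial2_def p vector_derivative_at)
    \<comment> \<open>In the first derivative the commutator of \<open>u\<close> and
      \<open>v\<close> cancels against \<open>v_xi\<close>, leaving the conjugate of [a, v]; by
      \<open>a_eta\<close> the second leaves that of [v, a].\<close>
    ultimately show ?thesis
      by (simp add: a_eta v_xi bracket_def matrix_simps)
  qed
  have "partial2 (in_xt (\<lambda>p. L p - J p)) q = partial1 (in_xt (\<lambda>p. - (J p + L p))) q" for q
  proof -
    obtain x t where q: "q = (x, t)"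
      by fastforce
    define p where "p = ((x + t) / 2, (x - t) / 2)"
    note J' = differentiable_imp_has_vector_derivative_partials[OF smooth_map_differentiable[OF J_smooth]]
    note L' = differentiable_imp_has_vector_derivative_partials[OF smooth_map_differentiable[OF L_smooth]]
    have "partial2 (in_xt (\<lambda>p. L p - J p)) (x, t) =
        (1/2) *\<^sub>R ((partial1 L p - partial1 J p) - (partial2 L p - partial2 J p))"
      unfolding p_def
      by (intro partials_in_xt has_derivative_from_partials differentiable_diff
          has_vector_derivative_diff J' L'
          smooth_map_differentiable J_smooth L_smooth)
    \<comment> \<open>The two sides of the wave equation share the terms in
      \<open>partial1 J\<close> and \<open>partial2 L\<close>; their difference is exactly
      \<open>partial1 L p + partial2 J p\<close>, which \<open>conservation\<close> makes
      zero.\<close>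
    also have "\<dots> = (1/2) *\<^sub>R (- (partial1 J p + partial1 L p) + - (partial2 J p + partial2 L p))"
    proof -
      have "partial2 J p = - partial1 L p"
        using conservation by (simp add: eq_neg_iff_add_eq_0 add.commute)
      then show ?thesis by simp
    qed
    also have "\<dots> = partial1 (in_xt (\<lambda>p. - (J p + L p))) (x, t)"
      unfolding p_def
      by (intro partials_in_xt[symmetric] has_derivative_from_partials differentiable_minus
          differentiable_add has_vector_derivative_minus has_vector_derivative_add J' L' smooth_map_differentiable
          J_smooth L_smooth)
    finally show ?thesis
      by (simp add: q)
  qed
  then have "wave_map_SU2 (in_xt s)"
    using s_smooth s_SU2 unfolding wave_map_SU2_def s_x s_t smooth_map_def
    by (auto simp: class_C_in_xt in_xt_apply)
  then show ?thesis
    using s_SU2 s_sym by (auto simp: wave_map_S2_def S2_sphere_def in_xt_apply)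
qed

end
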